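(* Let $\mathcal{L}$ be a finite lattice with a fixed reverse topological sort $x_1,\ldots,x_n$. Let $(\mathcal{L}',\leq,\lor)$ be a finite distributive join-semilattice and let $f:\mathcal{L}\to\mathcal{L}'$ be an injective homomorphism of join-semilattices. Let $x,z\in\mathcal{L}$ with $x<z$, and let $Y\subseteq \mathrm{lc}(z)$ be the set of those lower covers of $z$ that appear strictly before $x$ in the reverse topological sort. Then $x\prec z$ if and only if $$f(x)\lor\Big(\bigwedge_{y\in Y} f(y)\Big)\geq f(z),$$ where the meet is taken in (the lattice extension of) $\mathcal{L}'$, and the meet of the empty set is $\top$.
   Context: All structures are finite. $x\prec z$ means that $x$ is an immediate predecessor of $z$: $x<z$ and there is no $w$ with $x<w<z$. The lower cover of $z$ is $\mathrm{lc}(z)=\{y : y\prec z\}$. A reverse topological sort of a lattice $\mathcal{L}$ with $n$ elements is an enumeration $x_1,\ldots,x_n$ of all its elements, each exactly once, such that $x_i\leq x_j$ always implies $j\leq i$. A finite join-semilattice is extended into a lattice by adding an artificial bottom element if it has none, and defining $\bigwedge X=\bigvee\{y : \forall x\in X,\ y\leq x\}$; in particular the empty meet is the top element $\top$. The join-semilattice $\mathcal{L}'$ is called distributive if this lattice extension is a distributive lattice. A homomorphism of join-semilattices $f:S\to T$ is a map with $f(x\lor y)=f(x)\lor f(y)$ for all $x,y$; if both $S$ and $T$ have a bottom element, it is also required that $f(\bot)=\bot$. Preservation of meets is not required. *)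

theory Defs
  imports Main "HOL-Library.Option_ord"
begin

definition covered_by :: "'a::order \<Rightarrow> 'a \<Rightarrow> bool"  (infix "\<prec>" 50) where
  "x \<prec> z \<longleftrightarrow> x < z \<and> (\<nexists>w. x < w \<and> w < z)"

definition lower_cover :: "'a::order \<Rightarrow> 'a set" where
  "lower_cover z = {y. y \<prec> z}"

definition reverse_topological_sort :: "'a::order list \<Rightarrow> bool" where
  "reverse_topological_sort xs \<longleftrightarrow> distinct xs \<and> set xs = UNIV \<and>
     (\<forall>i < length xs. \<forall>j < length xs. xs ! i \<le> xs ! j \<longrightarrow> j \<le> i)"

definition strictly_before :: "'a list \<Rightarrow> 'a \<Rightarrow> 'a \<Rightarrow> bool" where
  "strictly_before xs y x \<longleftrightarrow> (\<exists>i j. i < j \<and> j < length xs \<and> xs ! i = y \<and> xs ! j = x)"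

definition is_bottom :: "'a::order \<Rightarrow> bool" where
  "is_bottom b \<longleftrightarrow> (\<forall>x. b \<le> x)"

definition join_hom :: "('a::semilattice_sup \<Rightarrow> 'b::semilattice_sup) \<Rightarrow> bool" where
  "join_hom f \<longleftrightarrow> (\<forall>x y. f (sup x y) = sup (f x) (f y)) \<and>
     (\<forall>b c. is_bottom b \<longrightarrow> is_bottom c \<longrightarrow> f b = c)"

text \<open>
  The lattice extension of a finite join-semilattice lives inside the option type, ordered
  with \<^const>\<open>None\<close> below everything: \<^const>\<open>Some\<close> embeds the semilattice, and
  \<^const>\<open>None\<close> is the artificial bottom, which belongs to the extension only if the
  semilattice has no bottom of its own. Order and join are those of \<^theory>\<open>HOL-Library.Option_ord\<close>.
  The meet operation of that theory is not used, since it presupposes meets on the semilattice.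
\<close>

definition ext_carrier :: "'b::semilattice_sup option set" where
  "ext_carrier = (if \<exists>b::'b. is_bottom b then range Some else UNIV)"

text \<open>
  The set of lower bounds below always contains the bottom of the extension, so its join is a
  join of a nonempty finite set.
\<close>

definition ext_Meet :: "'b::{finite, semilattice_sup} option set \<Rightarrow> 'b option" where
  "ext_Meet X = Sup_fin {y \<in> ext_carrier. \<forall>x \<in> X. y \<le> x}"

definition distributive_join_semilattice :: "'b::{finite, semilattice_sup} itself \<Rightarrow> bool" where
  "distributive_join_semilattice _ \<longleftrightarrow>
     (\<forall>x \<in> ext_carrier. \<forall>y \<in> ext_carrier. \<forall>z \<in> (ext_carrier :: 'b option set).
        ext_Meet {x, sup y z} = sup (ext_Meet {x, y}) (ext_Meet {x, z}))"

lemma ext_lower_bounds_nonempty: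
  "{y \<in> (ext_carrier :: 'b::semilattice_sup option set). \<forall>x \<in> X. y \<le> x} \<noteq> {}"
  if "X \<subseteq> ext_carrier" for X
proof (cases "\<exists>b::'b. is_bottom b")
  case True
  then obtain b :: 'b where "is_bottom b" by blast
  have carrier: "(ext_carrier :: 'b option set) = range Some"
    using True by (simp add: ext_carrier_def)
  have "Some b \<le> x" if "x \<in> range Some" for x
    using that \<open>is_bottom b\<close> by (auto simp: is_bottom_def)
  then have "Some b \<in> {y \<in> ext_carrier. \<forall>x \<in> X. y \<le> x}"
    using that carrier by auto
  then show ?thesis by blast
next
  case False
  then have "None \<in> {y \<in> ext_carrier. \<forall>x \<in> X. y \<le> x}"
    by (simp add: ext_carrier_def)
  then show ?thesis by blast
qed

lemma sup_in_ext_carrier: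
  "x \<in> ext_carrier \<Longrightarrow> y \<in> ext_carrier \<Longrightarrow> sup x y \<in> ext_carrier"
  by (auto simp: ext_carrier_def split: if_splits)

lemma ext_Meet_in_ext_carrier:
  fixes X :: "'b::{finite, semilattice_sup} option set"
  assumes "X \<subseteq> ext_carrier"
  shows "ext_Meet X \<in> ext_carrier"
proof -
  have "Sup_fin A \<in> ext_carrier" if "finite A" "A \<noteq> {}" "A \<subseteq> ext_carrier"
    for A :: "'b option set"
    using that by (induction A rule: finite_ne_induct) (auto intro: sup_in_ext_carrier)
  then show ?thesis
    unfolding ext_Meet_def using ext_lower_bounds_nonempty[OF assms] by auto
qed

lemma ext_Meet_lower:
  fixes X :: "'b::{finite, semilattice_sup} option set"
  assumes "X \<subseteq> ext_carrier" "x \<in> X"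
  shows "ext_Meet X \<le> x"
  unfolding ext_Meet_def
  using ext_lower_bounds_nonempty[OF assms(1)] assms(2)
  by (intro Sup_fin.boundedI) auto

lemma ext_Meet_greatest:
  fixes X :: "'b::{finite, semilattice_sup} option set"
  assumes "y \<in> ext_carrier" "\<And>x. x \<in> X \<Longrightarrow> y \<le> x"
  shows "y \<le> ext_Meet X"
  unfolding ext_Meet_def using assms by (intro Sup_fin.coboundedI) auto

end

theory Submission
  imports Defs
begin

text \<open>
  Two distinct lower covers of \<open>z\<close> have join \<open>z\<close>. Hence if \<open>x \<prec> z\<close>, every \<open>y \<in> Y\<close> satisfies
  \<open>f x \<squnion> f y = f z\<close>, and distributivity moves the meet over \<open>Y\<close> outside the join. Conversely, if
  \<open>x\<close> is not a lower cover of \<open>z\<close>, some lower cover \<open>y\<close> of \<open>z\<close> lies strictly above \<open>x\<close>; it comes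
  before \<open>x\<close> in the sort, so the left-hand side is at most \<open>f y\<close>, which is strictly below \<open>f z\<close>
  by injectivity.
\<close>

lemma ext_Meet_pair_absorb:
  fixes a b :: "'b::{finite, semilattice_sup} option"
  assumes "a \<in> ext_carrier" "b \<in> ext_carrier" "a \<le> b"
  shows "ext_Meet {a, b} = a"
  using assms by (intro antisym ext_Meet_lower ext_Meet_greatest) auto

text \<open>The definition of distributivity moves a binary meet over a join. What is needed is the
  dual law for a meet of arbitrarily many elements, obtained by induction on
  \<open>X\<close>.\<close>

lemma le_sup_ext_Meet:
  fixes a c :: "'b::{finite, semilattice_sup} option"
  assumes distrib: "distributive_join_semilattice TYPE('b)"
    and "X \<subseteq> ext_carrier" "a \<in> ext_carrier" "c \<in> ext_carrier"
    and "\<And>x. x \<in> X \<Longrightarrow> c \<le> sup a x"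
  shows "c \<le> sup a (ext_Meet X)"
proof -
  \<comment> \<open>Since \<open>u\<close> lies below \<open>sup a v\<close>, it equals its meet
    with that join; distributivity then expands the meet.\<close>
  have split: "u = sup (ext_Meet {u, a}) (ext_Meet {u, v})"
    if "u \<in> ext_carrier" "v \<in> ext_carrier" "u \<le> sup a v" for u v :: "'b option"
    using distrib that assms(3) ext_Meet_pair_absorb[of u "sup a v"]
    by (simp add: distributive_join_semilattice_def sup_in_ext_carrier)
  have "finite X" by simp
  then show ?thesis
    using assms(2,5)
  proof (induction X rule: finite_induct)
    case empty
    \<comment> \<open>The empty meet is the top element, as every element is vacuously a lower
      bound.\<close>
    have "c \<le> ext_Meet {}"
      using assms(4) by (intro ext_Meet_greatest) auto
    then show ?case by (rule le_supI2)
  next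
    case (insert x X)
    \<comment> \<open>Splitting \<open>c\<close> along \<open>a\<close> and \<open>x\<close> leaves
      \<open>u\<close>; splitting \<open>u\<close> along \<open>a\<close> and
      \<open>ext_Meet X\<close> leaves \<open>v\<close>. The pieces split off lie below
      \<open>a\<close>, so \<open>c\<close> is at most \<open>sup a v\<close>, and \<open>v\<close>
      is below both \<open>x\<close> and \<open>ext_Meet X\<close>.\<close>
    define u where "u = ext_Meet {c, x}"
    define v where "v = ext_Meet {u, ext_Meet X}"
    have x: "x \<in> ext_carrier" and X: "X \<subseteq> ext_carrier"
      using insert.prems(1) by auto
    have M: "ext_Meet X \<in> ext_carrier"
      using X by (rule ext_Meet_in_ext_carrier)
    have u: "u \<in> ext_carrier" "u \<le> c" "u \<le> x"
      unfolding u_def using assms(4) x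
      by (auto intro!: ext_Meet_in_ext_carrier ext_Meet_lower)
    have v: "v \<in> ext_carrier" "v \<le> u" "v \<le> ext_Meet X"
      unfolding v_def using u(1) M
      by (auto intro!: ext_Meet_in_ext_carrier ext_Meet_lower)
    have "c \<le> sup a (ext_Meet X)"
      using insert.IH X insert.prems(2) by blast
    then have "u \<le> sup a (ext_Meet X)"
      using u(2) by (rule order_trans[rotated])
    then have u_eq: "u = sup (ext_Meet {u, a}) v"
      unfolding v_def using u(1) M by (intro split)
    have "c = sup (ext_Meet {c, a}) u"
      unfolding u_def using assms(4) x insert.prems(2) by (intro split) auto
    moreover have "ext_Meet {c, a} \<le> a" "ext_Meet {u, a} \<le> a"
      using assms(3,4) u(1) by (auto intro: ext_Meet_lower)
    ultimately have "c \<le> sup a v"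
      using u_eq by (metis le_supI le_supI1 sup.cobounded2)
    moreover have "v \<le> y" if "y \<in> insert x X" for y
      using that v u(3) ext_Meet_lower[OF X, of y] by (auto intro: order_trans)
    then have "v \<le> ext_Meet (insert x X)"
      using v(1) by (intro ext_Meet_greatest)
    ultimately show ?case
      by (meson order_trans sup.mono order_refl)
  qed
qed

text \<open>A join strictly below \<open>z\<close> cannot lie strictly above either cover, so it
  would equal both.\<close>

lemma sup_lower_covers:
  fixes x y z :: "'a::semilattice_sup"
  assumes "x \<prec> z" "y \<prec> z" "x \<noteq> y"
  shows "sup x y = z"
proof (rule ccontr)
  assume "sup x y \<noteq> z"
  then have "sup x y < z"
    using assms(1,2) by (simp add: covered_by_def order.strict_iff_order)
  then have "\<not> x < sup x y" "\<not> y < sup x y"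
    using assms(1,2) by (auto simp: covered_by_def)
  then show False
    using assms(3) by (metis sup.cobounded1 sup.cobounded2 order.not_eq_order_implies_strict)
qed

lemma ex_lower_cover_ge:
  fixes x z :: "'a::{finite, order}"
  assumes "x < z"
  obtains y where "x \<le> y" "y \<prec> z"
proof -
  \<comment> \<open>By finiteness, some element above \<open>x\<close> is maximal among those
    strictly below \<open>z\<close>; maximality makes it a lower cover.\<close>
  obtain y where y: "y \<in> {w. w < z}" "x \<le> y" "\<forall>w \<in> {w. w < z}. y \<le> w \<longrightarrow> y = w"
    using assms finite_has_maximal2[of "{w. w < z}" x] by auto
  then have "y \<prec> z"
    by (auto simp: covered_by_def)
  with y(2) show thesis by (rule that)
qed

lemma reverse_topological_sort_strictly_before:
  assumes "reverse_topological_sort xs" "x < y"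
  shows "strictly_before xs y x"
proof -
  have "x \<in> set xs" "y \<in> set xs"
    using assms(1) by (auto simp: reverse_topological_sort_def)
  then obtain i j where ij: "i < length xs" "xs ! i = x" "j < length xs" "xs ! j = y"
    by (metis in_set_conv_nth)
  with assms have "j \<le> i" "j \<noteq> i"
    by (auto simp: reverse_topological_sort_def)
  with ij show ?thesis
    unfolding strictly_before_def by (intro exI[of _ j] exI[of _ i]) auto
qed

lemma strictly_before_imp_neq:
  assumes "distinct xs" "strictly_before xs y x"
  shows "y \<noteq> x"
  using assms by (auto simp: strictly_before_def nth_eq_iff_index_eq)

lemma join_hom_mono:
  assumes "join_hom f" "x \<le> y"
  shows "f x \<le> f y"
  using assms by (metis join_hom_def sup.cobounded1 sup.absorb2)

theorem theorem3:
  fixes xs :: "'a::{finite, lattice} list"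
    and f :: "'a \<Rightarrow> 'b::{finite, semilattice_sup}"
    and x z :: 'a
    and Y :: "'a set"
  assumes "reverse_topological_sort xs"
    and "distributive_join_semilattice TYPE('b)"
    and "join_hom f"
    and "inj f"
    and "x < z"
    and "Y = {y \<in> lower_cover z. strictly_before xs y x}"
  shows "x \<prec> z \<longleftrightarrow> sup (Some (f x)) (ext_Meet ((\<lambda>y. Some (f y)) ` Y)) \<ge> Some (f z)"
proof
  have Some_carrier: "Some b \<in> ext_carrier" for b :: 'b
    by (simp add: ext_carrier_def)
  {
    assume "x \<prec> z"
    have "Some (f z) \<le> sup (Some (f x)) (Some (f y))" if "y \<in> Y" for y
    proof -
      \<comment> \<open>The sort lists each element once, so nothing strictly before
        \<open>x\<close> equals \<open>x\<close>.\<close>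
      have "y \<prec> z" "y \<noteq> x"
        using that assms(1,6) strictly_before_imp_neq[of xs y x]
        by (auto simp: lower_cover_def reverse_topological_sort_def)
      then have "sup x y = z"
        using \<open>x \<prec> z\<close> by (intro sup_lower_covers) auto
      then have "sup (f x) (f y) = f z"
        using assms(3) by (auto simp: join_hom_def)
      then show ?thesis by simp
    qed
    then show "Some (f z) \<le> sup (Some (f x)) (ext_Meet ((\<lambda>y. Some (f y)) ` Y))"
      using assms(2) Some_carrier by (intro le_sup_ext_Meet) auto
  next
    assume le: "Some (f z) \<le> sup (Some (f x)) (ext_Meet ((\<lambda>y. Some (f y)) ` Y))"
    obtain y where y: "x \<le> y" "y \<prec> z"
      using assms(5) by (rule ex_lower_cover_ge)
    show "x \<prec> z"
    proof (cases "x = y")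
      case False
      then have "y \<in> Y"
        using y assms(1,6) by (auto simp: lower_cover_def intro: reverse_topological_sort_strictly_before)
      then have "ext_Meet ((\<lambda>y. Some (f y)) ` Y) \<le> Some (f y)"
        using Some_carrier by (intro ext_Meet_lower) auto
      moreover have "Some (f x) \<le> Some (f y)"
        using join_hom_mono[OF assms(3) y(1)] by simp
      ultimately have "Some (f z) \<le> Some (f y)"
        using le by (meson order_trans le_supI)
      moreover have "f y \<le> f z"
        using assms(3) y(2) by (auto simp: covered_by_def intro: join_hom_mono)
      \<comment> \<open>This contradicts \<open>y \<prec> z\<close>, so only the case
        \<open>x = y\<close> survives.\<close>
      ultimately have "y = z"
        using assms(4) by (simp add: inj_eq)
      with y(2) show ?thesis by (simp add: covered_by_def)
    qed (use y in simp)
  }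
qed

end
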